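(* Let $S$ be a finite set of points in the plane (the real affine plane or the real projective plane), with each point coloured red or blue or with both colours. Suppose that for any two distinct points $A,B\in S$ sharing a colour there is a third point $C\in S$ of the other colour, collinear with $A$ and $B$. Then all the points in $S$ are collinear.
   Context: A point may carry one colour or both colours; "red" includes points carrying both colours, and likewise "blue". The hypothesis means: whenever $A\neq B$ in $S$ are both blue, there is a red point $C\in S\setminus\{A,B\}$ on the line $AB$; and whenever $A\neq B$ in $S$ are both red, there is a blue point $C\in S\setminus\{A,B\}$ on the line $AB$. (If $A,B$ share both colours, both requirements apply.) The point $C$ is allowed to carry both colours. *)

theory Defs
  imports "HOL-Analysis.Analysis"
begin

text \<open>The real projective plane: its points are the one-dimensional linear subspaces of
  \<open>\<real>\<^sup>3\<close> and its lines are the two-dimensional ones, with incidence given by inclusion.\<close>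

typedef proj_plane = "{P :: (real^3) set. subspace P \<and> dim P = 1}"
  morphisms proj_subspace Abs_proj_plane
proof -
  have "subspace (span {axis 1 1 :: real^3})" "dim (span {axis 1 1 :: real^3}) = 1"
    by (simp_all add: dim_insert axis_eq_0_iff)
  then show ?thesis by blast
qed

definition proj_line :: "(real^3) set \<Rightarrow> bool" where
  "proj_line L \<longleftrightarrow> subspace L \<and> dim L = 2"

definition proj_collinear :: "proj_plane set \<Rightarrow> bool" where
  "proj_collinear T \<longleftrightarrow> (\<exists>L. proj_line L \<and> (\<forall>P\<in>T. proj_subspace P \<subseteq> L))"

text \<open>The colouring is given by the sets \<open>R\<close> and \<open>B\<close> of red and blue points, which may
  overlap: the points of \<open>R \<inter> B\<close> carry both colours. The parameter \<open>col\<close> is the collinearity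
  predicate of the plane in question.\<close>

definition third_point_of_other_colour ::
    "('p set \<Rightarrow> bool) \<Rightarrow> 'p set \<Rightarrow> 'p set \<Rightarrow> bool" where
  "third_point_of_other_colour col R B \<longleftrightarrow>
     (\<forall>P\<in>B. \<forall>Q\<in>B. P \<noteq> Q \<longrightarrow> (\<exists>X\<in>R - {P, Q}. col {P, Q, X})) \<and>
     (\<forall>P\<in>R. \<forall>Q\<in>R. P \<noteq> Q \<longrightarrow> (\<exists>X\<in>B - {P, Q}. col {P, Q, X}))"

end

theory Submission
  imports Defs
begin

text \<open>
  A point of the projective plane is a vector up to a nonzero factor, and three points are collinear
  iff their vectors are linearly dependent; an affine point \<open>x\<close> becomes \<open>(x, 1)\<close>. This
  reduces both planes to one statement about a finite symmetric set \<open>R\<close> of red and a finite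
  symmetric set \<open>B\<close> of blue vectors: if any two independent vectors of one colour have a
  combination with nonzero coefficients in the other colour, then no two red vectors and a blue one
  are independent (\<open>no_independent_triple\<close>). The coplanarity of all vectors follows
  quickly (\<open>coloured_points_in_span_of_red_pair\<close>): all blue points lie on the line of two
  red points \<open>P\<close>, \<open>Q\<close>, and a blue point other than \<open>P\<close> carries every further red
  point back to that line.

  The statement about vectors is proved by a descent that is best seen in the dual plane, where a
  vector is the normal of a line. Take a triangle with two red sides \<open>a\<close>, \<open>b\<close> and a blue
  side \<open>c\<close>, cut in two by a blue line \<open>d\<close> through the vertex on \<open>a\<close> and \<open>b\<close>. The
  blue lines \<open>c\<close>, \<open>d\<close> meet inside the side \<open>c\<close>, so some red line \<open>e\<close> passes
  through this point, and it leaves the triangle through the interior of one of the sides \<open>a\<close>,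
  \<open>b\<close>, say \<open>a\<close>. Through the exit point, which lies on the red lines \<open>a\<close>, \<open>e\<close>, there is
  a blue line \<open>f\<close>. One of the two smaller triangles at that point, with sides \<open>a\<close>, \<open>e\<close>,
  \<open>c\<close> or \<open>a\<close>, \<open>e\<close>, \<open>d\<close>, is cut in two by \<open>f\<close>, and it is again of the
  original kind (\<open>split_triangle_descent\<close>). There are finitely many triangles, so this is
  impossible. Any independent triple of two red vectors and a blue one, however, gives such a
  triangle: a blue line through the vertex of the two red lines cuts one of the triangles that the
  three lines bound in the projective plane, and a change of sign of one normal selects it.

  That the red lines in this figure differ from the blue ones follows from their position and not
  from their colours, so the argument covers points with both colours. It uses order only
  through the signs of coefficients, so it applies to vectors of any real vector space.
\<close>

section \<open>Linear preliminaries\<close>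

definition independent_pair :: "'a::real_vector \<Rightarrow> 'a \<Rightarrow> bool" where
  "independent_pair u v \<longleftrightarrow> (\<forall>x y. x *\<^sub>R u + y *\<^sub>R v = 0 \<longrightarrow> x = 0 \<and> y = 0)"

definition independent_triple :: "'a::real_vector \<Rightarrow> 'a \<Rightarrow> 'a \<Rightarrow> bool" where
  "independent_triple u v w \<longleftrightarrow>
     (\<forall>x y z. x *\<^sub>R u + y *\<^sub>R v + z *\<^sub>R w = 0 \<longrightarrow> x = 0 \<and> y = 0 \<and> z = 0)"

text \<open>For vectors read as normals of lines, this is the dual of the cone
  \<open>{x. u \<bullet> x \<ge> 0 \<and> v \<bullet> x \<ge> 0 \<and> w \<bullet> x \<ge> 0}\<close> over the triangle that the three lines
  bound. A smaller triangle therefore has a larger cone, and working with the dual avoids inner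
  products.\<close>
definition triangle_cone :: "'a::real_vector \<Rightarrow> 'a \<Rightarrow> 'a \<Rightarrow> 'a set" where
  "triangle_cone u v w = {x *\<^sub>R u + y *\<^sub>R v + z *\<^sub>R w | x y z. 0 \<le> x \<and> 0 \<le> y \<and> 0 \<le> z}"

lemma triangle_coneI:
  "p = x *\<^sub>R u + y *\<^sub>R v + z *\<^sub>R w \<Longrightarrow> 0 \<le> x \<Longrightarrow> 0 \<le> y \<Longrightarrow> 0 \<le> z \<Longrightarrow> p \<in> triangle_cone u v w"
  unfolding triangle_cone_def by blast

lemma triangle_cone_add:
  assumes "p \<in> triangle_cone u v w" "q \<in> triangle_cone u v w"
  shows "p + q \<in> triangle_cone u v w"
proof -
  obtain x y z x' y' z' where
    "p = x *\<^sub>R u + y *\<^sub>R v + z *\<^sub>R w" "q = x' *\<^sub>R u + y' *\<^sub>R v + z' *\<^sub>R w"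
    and "0 \<le> x" "0 \<le> y" "0 \<le> z" "0 \<le> x'" "0 \<le> y'" "0 \<le> z'"
    using assms unfolding triangle_cone_def by blast
  then show ?thesis
    by (intro triangle_coneI[of _ "x + x'" _ "y + y'" _ "z + z'"]) (simp_all add: algebra_simps)
qed

lemma triangle_cone_scaleR:
  assumes "p \<in> triangle_cone u v w" "0 \<le> t"
  shows "t *\<^sub>R p \<in> triangle_cone u v w"
proof -
  obtain x y z where
    "p = x *\<^sub>R u + y *\<^sub>R v + z *\<^sub>R w" and "0 \<le> x" "0 \<le> y" "0 \<le> z"
    using assms unfolding triangle_cone_def by blast
  then show ?thesis
    using assms(2)
    by (intro triangle_coneI[of _ "t * x" _ "t * y" _ "t * z"]) (simp_all add: algebra_simps)
qed

lemma triangle_cone_mono: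
  assumes "u \<in> triangle_cone u' v' w'" "v \<in> triangle_cone u' v' w'" "w \<in> triangle_cone u' v' w'"
  shows "triangle_cone u v w \<subseteq> triangle_cone u' v' w'"
proof
  fix p assume "p \<in> triangle_cone u v w"
  then obtain x y z where
    "p = x *\<^sub>R u + y *\<^sub>R v + z *\<^sub>R w" and "0 \<le> x" "0 \<le> y" "0 \<le> z"
    unfolding triangle_cone_def by blast
  then show "p \<in> triangle_cone u' v' w'"
    using assms by (simp add: triangle_cone_add triangle_cone_scaleR)
qed

lemma triangle_cone_generators:
  "u \<in> triangle_cone u v w" "v \<in> triangle_cone u v w" "w \<in> triangle_cone u v w"
proof -
  show "u \<in> triangle_cone u v w" by (rule triangle_coneI[of _ 1 _ 0 _ 0]) auto
  show "v \<in> triangle_cone u v w" by (rule triangle_coneI[of _ 0 _ 1 _ 0]) auto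
  show "w \<in> triangle_cone u v w" by (rule triangle_coneI[of _ 0 _ 0 _ 1]) auto
qed

lemma triangle_cone_swap: "triangle_cone a b c = triangle_cone b a c"
  by (intro equalityI triangle_cone_mono triangle_cone_generators)

lemma independent_triple_coeffs_eq:
  assumes "independent_triple u v w"
    and "x *\<^sub>R u + y *\<^sub>R v + z *\<^sub>R w = x' *\<^sub>R u + y' *\<^sub>R v + z' *\<^sub>R w"
  shows "x = x' \<and> y = y' \<and> z = z'"
proof -
  have "(x - x') *\<^sub>R u + (y - y') *\<^sub>R v + (z - z') *\<^sub>R w = 0"
    using assms(2) by (simp add: algebra_simps)
  then have "x - x' = 0 \<and> y - y' = 0 \<and> z - z' = 0"
    using assms(1) unfolding independent_triple_def by blast
  then show ?thesis by simp
qed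

lemma triangle_cone_coeffs_nonneg:
  assumes "independent_triple u v w" "x *\<^sub>R u + y *\<^sub>R v + z *\<^sub>R w \<in> triangle_cone u v w"
  shows "0 \<le> x \<and> 0 \<le> y \<and> 0 \<le> z"
proof -
  obtain x' y' z' where
    "x *\<^sub>R u + y *\<^sub>R v + z *\<^sub>R w = x' *\<^sub>R u + y' *\<^sub>R v + z' *\<^sub>R w"
    and "0 \<le> x'" "0 \<le> y'" "0 \<le> z'"
    using assms(2) unfolding triangle_cone_def by blast
  then show ?thesis using independent_triple_coeffs_eq[OF assms(1)] by metis
qed

lemma independent_triple_swap:
  "independent_triple a b c \<longleftrightarrow> independent_triple b a c"
  unfolding independent_triple_def by (metis add.commute)

lemma independent_triple_imp_pair:
  "independent_triple a b c \<Longrightarrow> independent_pair a b"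
  unfolding independent_triple_def independent_pair_def by (metis add_0_right scaleR_zero_left)

lemma independent_triple_uminus_2:
  assumes "independent_triple a b c" shows "independent_triple a (- b) c"
  unfolding independent_triple_def
proof (intro allI impI)
  fix x y z assume "x *\<^sub>R a + y *\<^sub>R - b + z *\<^sub>R c = 0"
  then have "x *\<^sub>R a + (- y) *\<^sub>R b + z *\<^sub>R c = 0" by simp
  then show "x = 0 \<and> y = 0 \<and> z = 0"
    using assms unfolding independent_triple_def by (metis neg_equal_0_iff_equal)
qed

lemma in_span_pair: "p \<in> span {u, v} \<longleftrightarrow> (\<exists>x y. p = x *\<^sub>R u + y *\<^sub>R v)"
proof -
  have "p \<in> span {u, v} \<longleftrightarrow> (\<exists>x y. p - x *\<^sub>R u = y *\<^sub>R v)"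
    by (auto simp: span_insert span_singleton)
  then show ?thesis by (simp add: diff_eq_eq add.commute)
qed

lemma not_independent_triple_imp_span:
  assumes "independent_pair u v" "\<not> independent_triple u v w"
  shows "w \<in> span {u, v}"
proof -
  obtain x y z where eq: "x *\<^sub>R u + y *\<^sub>R v + z *\<^sub>R w = 0" and nz: "\<not> (x = 0 \<and> y = 0 \<and> z = 0)"
    using assms(2) unfolding independent_triple_def by blast
  have "z \<noteq> 0"
  proof
    assume "z = 0"
    then have "x *\<^sub>R u + y *\<^sub>R v = 0" using eq by simp
    then show False using assms(1) nz \<open>z = 0\<close> unfolding independent_pair_def by blast
  qed
  have "z *\<^sub>R w = (- x) *\<^sub>R u + (- y) *\<^sub>R v"
    using eq by (simp add: add_eq_0_iff)
  then have "(1 / z) *\<^sub>R z *\<^sub>R w = (1 / z) *\<^sub>R ((- x) *\<^sub>R u + (- y) *\<^sub>R v)" by simp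
  then have "w = (- x / z) *\<^sub>R u + (- y / z) *\<^sub>R v"
    using \<open>z \<noteq> 0\<close> by (simp add: scaleR_diff_right)
  then show ?thesis unfolding in_span_pair by blast
qed


section \<open>The descent\<close>

text \<open>This is the colour hypothesis for one colour. Nonzero coefficients say that the third point
  differs from the two given ones.\<close>
definition spans_third :: "'a::real_vector set \<Rightarrow> 'a set \<Rightarrow> bool" where
  "spans_third B R \<longleftrightarrow> (\<forall>p\<in>B. \<forall>q\<in>B. independent_pair p q \<longrightarrow>
     (\<exists>r\<in>R. \<exists>x y. x \<noteq> 0 \<and> y \<noteq> 0 \<and> r = x *\<^sub>R p + y *\<^sub>R q))"

lemma spans_thirdE:
  assumes "spans_third B R" "\<And>r. r \<in> R \<Longrightarrow> - r \<in> R"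
    and "p \<in> B" "q \<in> B" "independent_pair p q"
  obtains r x y where "r \<in> R" "0 < x" "y \<noteq> 0" "r = x *\<^sub>R p + y *\<^sub>R q"
proof -
  obtain r x y where r: "r \<in> R" "x \<noteq> 0" "y \<noteq> 0" "r = x *\<^sub>R p + y *\<^sub>R q"
    using assms unfolding spans_third_def by blast
  show thesis
  proof (cases "0 < x")
    case True
    then show thesis using r that by blast
  next
    case False
    have "- r = (- x) *\<^sub>R p + (- y) *\<^sub>R q" using r by simp
    moreover have "- r \<in> R" using r(1) assms(2) by blast
    moreover have "0 < - x" "- y \<noteq> 0" using r(2,3) False by auto
    ultimately show thesis using that by blast
  qed
qed

text \<open>In the dual picture the line with normal \<open>x *\<^sub>R a - y *\<^sub>R b\<close> goes through the common point
  of \<open>a\<close> and \<open>b\<close>. The opposite signs say that it meets the interior of the triangle: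
  it takes both signs on the cone where \<open>a\<close> and \<open>b\<close> are positive.\<close>
definition split_triangle :: "'a::real_vector set \<Rightarrow> 'a set \<Rightarrow> 'a \<Rightarrow> 'a \<Rightarrow> 'a \<Rightarrow> bool" where
  "split_triangle R B a b c \<longleftrightarrow> a \<in> R \<and> b \<in> R \<and> c \<in> B \<and> independent_triple a b c \<and>
     (\<exists>x>0. \<exists>y>0. x *\<^sub>R a - y *\<^sub>R b \<in> B)"

text \<open>This is the descent in the case that the red line \<open>e = \<kappa> d + \<mu> c\<close> leaves the triangle
  through the side \<open>a\<close>: with both coefficients positive, \<open>e\<close> is positive at the vertex on \<open>a\<close>
  and \<open>b\<close> and negative at the vertex on \<open>a\<close> and \<open>c\<close>. On which side of \<open>e\<close> the blue line
  \<open>f\<close> enters the triangle is decided by the sign of the coefficient of \<open>e\<close> in \<open>f\<close>.\<close>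
lemma split_triangle_descent_aux:
  assumes symR: "\<And>r. r \<in> R \<Longrightarrow> - r \<in> R" and symB: "\<And>r. r \<in> B \<Longrightarrow> - r \<in> B"
    and RB: "spans_third R B"
    and a: "a \<in> R" and c: "c \<in> B" and ind: "independent_triple a b c"
    and pos: "0 < \<alpha>" "0 < \<beta>" "0 < \<kappa>" "0 < \<mu>"
    and d: "\<alpha> *\<^sub>R a - \<beta> *\<^sub>R b \<in> B"
    and e: "\<kappa> *\<^sub>R (\<alpha> *\<^sub>R a - \<beta> *\<^sub>R b) + \<mu> *\<^sub>R c \<in> R"
  shows "\<exists>a' b' c'. split_triangle R B a' b' c' \<and> triangle_cone a b c \<subset> triangle_cone a' b' c'"
proof -
  define d where "d = \<alpha> *\<^sub>R a - \<beta> *\<^sub>R b"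
  define e where "e = \<kappa> *\<^sub>R d + \<mu> *\<^sub>R c"
  have e_abc: "e = (\<kappa> * \<alpha>) *\<^sub>R a + (- \<kappa> * \<beta>) *\<^sub>R b + \<mu> *\<^sub>R c"
    by (simp add: e_def d_def algebra_simps)
  have dB: "d \<in> B" and eR: "e \<in> R" using d e by (simp_all add: d_def e_def)
  have ind_aec: "independent_triple a e c"
    unfolding independent_triple_def
  proof (intro allI impI)
    fix x y z assume "x *\<^sub>R a + y *\<^sub>R e + z *\<^sub>R c = 0"
    then have "(x + y * \<kappa> * \<alpha>) *\<^sub>R a + (- (y * \<kappa> * \<beta>)) *\<^sub>R b + (y * \<mu> + z) *\<^sub>R c = 0"
      by (simp add: e_abc algebra_simps)
    then have "x + y * \<kappa> * \<alpha> = 0 \<and> - (y * \<kappa> * \<beta>) = 0 \<and> y * \<mu> + z = 0"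
      using ind unfolding independent_triple_def by blast
    then show "x = 0 \<and> y = 0 \<and> z = 0" using pos by auto
  qed
  have ind_aed: "independent_triple a e (- d)"
    unfolding independent_triple_def
  proof (intro allI impI)
    fix x y z assume "x *\<^sub>R a + y *\<^sub>R e + z *\<^sub>R (- d) = 0"
    then have "(x + (y * \<kappa> - z) * \<alpha>) *\<^sub>R a + (- ((y * \<kappa> - z) * \<beta>)) *\<^sub>R b + (y * \<mu>) *\<^sub>R c = 0"
      by (simp add: e_def d_def algebra_simps)
    then have "x + (y * \<kappa> - z) * \<alpha> = 0 \<and> - ((y * \<kappa> - z) * \<beta>) = 0 \<and> y * \<mu> = 0"
      using ind unfolding independent_triple_def by blast
    then show "x = 0 \<and> y = 0 \<and> z = 0" using pos by auto
  qed
  obtain f \<rho> \<sigma> where f: "f \<in> B" "0 < \<rho>" "\<sigma> \<noteq> 0" and f_eq: "f = \<rho> *\<^sub>R a + \<sigma> *\<^sub>R e"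
    using spans_thirdE[OF RB symB a eR independent_triple_imp_pair[OF ind_aec]] by metis
  show ?thesis
  proof (cases "0 < \<sigma>")
    case True
    \<comment> \<open>\<open>f\<close> cuts the triangle with sides \<open>a\<close>, \<open>e\<close>, \<open>c\<close>, inside which \<open>e\<close> is negative.\<close>
    let ?K = "triangle_cone a (- e) c"
    have "\<rho> *\<^sub>R a - \<sigma> *\<^sub>R (- e) \<in> B" using f(1) f_eq by simp
    then have "split_triangle R B a (- e) c"
      unfolding split_triangle_def
      using a symR[OF eR] c independent_triple_uminus_2[OF ind_aec] f(2) True by blast
    moreover have "b \<in> ?K"
      by (rule triangle_coneI[of _ "\<alpha> / \<beta>" _ "1 / (\<kappa> * \<beta>)" _ "\<mu> / (\<kappa> * \<beta>)"])
        (use pos in \<open>simp_all add: e_abc algebra_simps\<close>)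
    then have "triangle_cone a b c \<subseteq> ?K"
      by (intro triangle_cone_mono triangle_cone_generators)
    moreover have "- e \<notin> triangle_cone a b c"
    proof
      assume "- e \<in> triangle_cone a b c"
      moreover have "- e = (- \<kappa> * \<alpha>) *\<^sub>R a + (\<kappa> * \<beta>) *\<^sub>R b + (- \<mu>) *\<^sub>R c"
        by (simp add: e_abc)
      ultimately have "0 \<le> - \<mu>" using triangle_cone_coeffs_nonneg[OF ind] by metis
      then show False using pos by simp
    qed
    ultimately show ?thesis using triangle_cone_generators(2)[of "- e" a c] by blast
  next
    case False
    \<comment> \<open>\<open>f\<close> cuts the triangle with sides \<open>a\<close>, \<open>e\<close>, \<open>d\<close>, inside which \<open>d\<close> is negative.\<close>
    let ?K = "triangle_cone a e (- d)"
    have "\<rho> *\<^sub>R a - (- \<sigma>) *\<^sub>R e \<in> B" using f(1) f_eq by simp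
    moreover have "0 < - \<sigma>" using False f(3) by simp
    ultimately have split: "split_triangle R B a e (- d)"
      unfolding split_triangle_def using a eR symB[OF dB] ind_aed f(2) by blast
    have "b \<in> ?K"
      by (rule triangle_coneI[of _ "\<alpha> / \<beta>" _ 0 _ "1 / \<beta>"])
        (use pos in \<open>simp_all add: d_def algebra_simps\<close>)
    moreover have "c \<in> ?K"
      by (rule triangle_coneI[of _ 0 _ "1 / \<mu>" _ "\<kappa> / \<mu>"])
        (use pos in \<open>simp_all add: e_def algebra_simps\<close>)
    ultimately have "triangle_cone a b c \<subseteq> ?K"
      by (intro triangle_cone_mono triangle_cone_generators)
    moreover have "- d \<notin> triangle_cone a b c"
    proof
      assume "- d \<in> triangle_cone a b c"
      moreover have "- d = (- \<alpha>) *\<^sub>R a + \<beta> *\<^sub>R b + 0 *\<^sub>R c"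
        by (simp add: d_def)
      ultimately have "0 \<le> - \<alpha>" using triangle_cone_coeffs_nonneg[OF ind] by metis
      then show False using pos by simp
    qed
    ultimately show ?thesis using split triangle_cone_generators(3)[of "- d" a e] by blast
  qed
qed

text \<open>The red line \<open>e\<close> may leave the triangle through \<open>a\<close> or through \<open>b\<close>; exchanging the
  two red sides, and \<open>d\<close> with its negative, turns one case into the other.\<close>
lemma split_triangle_descent:
  assumes symR: "\<And>r. r \<in> R \<Longrightarrow> - r \<in> R" and symB: "\<And>r. r \<in> B \<Longrightarrow> - r \<in> B"
    and RB: "spans_third R B" and BR: "spans_third B R"
    and split: "split_triangle R B a b c"
  shows "\<exists>a' b' c'. split_triangle R B a' b' c' \<and> triangle_cone a b c \<subset> triangle_cone a' b' c'"
proof -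
  obtain \<alpha> \<beta> where abc: "a \<in> R" "b \<in> R" "c \<in> B" "independent_triple a b c"
    and pos: "0 < \<alpha>" "0 < \<beta>" and d: "\<alpha> *\<^sub>R a - \<beta> *\<^sub>R b \<in> B"
    using split unfolding split_triangle_def by blast
  have "independent_pair c (\<alpha> *\<^sub>R a - \<beta> *\<^sub>R b)"
    unfolding independent_pair_def
  proof (intro allI impI)
    fix x y assume "x *\<^sub>R c + y *\<^sub>R (\<alpha> *\<^sub>R a - \<beta> *\<^sub>R b) = 0"
    then have "(y * \<alpha>) *\<^sub>R a + (- (y * \<beta>)) *\<^sub>R b + x *\<^sub>R c = 0"
      by (simp add: algebra_simps)
    then show "x = 0 \<and> y = 0"
      using abc(4) pos unfolding independent_triple_def by fastforce
  qed
  then obtain e \<mu> \<kappa> where e: "e \<in> R" "0 < \<mu>" "\<kappa> \<noteq> 0"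
    and e_eq: "e = \<mu> *\<^sub>R c + \<kappa> *\<^sub>R (\<alpha> *\<^sub>R a - \<beta> *\<^sub>R b)"
    using spans_thirdE[OF BR symR abc(3) d] by metis
  show ?thesis
  proof (cases "0 < \<kappa>")
    case True
    show ?thesis
      using split_triangle_descent_aux[OF symR symB RB abc(1,3,4) pos True e(2) d] e(1) e_eq
      by (simp add: add.commute)
  next
    case False
    then have "0 < - \<kappa>" using e(3) by simp
    have "independent_triple b a c" using abc(4) independent_triple_swap by blast
    moreover have "\<beta> *\<^sub>R b - \<alpha> *\<^sub>R a \<in> B" using symB[OF d] by simp
    moreover have "(- \<kappa>) *\<^sub>R (\<beta> *\<^sub>R b - \<alpha> *\<^sub>R a) + \<mu> *\<^sub>R c \<in> R"
      using e(1) e_eq by (simp add: algebra_simps)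
    ultimately show ?thesis
      using split_triangle_descent_aux[OF symR symB RB abc(2,3) _ pos(2,1) \<open>0 < - \<kappa>\<close> e(2)]
      by (metis triangle_cone_swap)
  qed
qed

lemma no_split_triangle:
  assumes fin: "finite R" "finite B"
    and symR: "\<And>r. r \<in> R \<Longrightarrow> - r \<in> R" and symB: "\<And>r. r \<in> B \<Longrightarrow> - r \<in> B"
    and RB: "spans_third R B" and BR: "spans_third B R"
  shows "\<not> split_triangle R B a b c"
proof
  assume split: "split_triangle R B a b c"
  define F where "F = {triangle_cone a b c | a b c. split_triangle R B a b c}"
  have "F \<subseteq> (\<lambda>(a, b, c). triangle_cone a b c) ` (R \<times> R \<times> B)"
    unfolding F_def split_triangle_def by auto
  then have "finite F" using fin by (meson finite_SigmaI finite_imageI finite_subset)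
  moreover have "F \<noteq> {}" using split unfolding F_def by blast
  ultimately obtain K where K: "K \<in> F" "\<And>L. L \<in> F \<Longrightarrow> K \<subseteq> L \<Longrightarrow> K = L"
    by (metis finite_has_maximal)
  from K(1) obtain a b c where "K = triangle_cone a b c" "split_triangle R B a b c"
    unfolding F_def by blast
  with split_triangle_descent[OF symR symB RB BR] obtain a' b' c'
    where "split_triangle R B a' b' c'" "K \<subset> triangle_cone a' b' c'"
    by metis
  then obtain L where "L \<in> F" "K \<subset> L" unfolding F_def by blast
  then show False using K(2) by blast
qed

text \<open>The blue vector spanned by \<open>a\<close> and \<open>b\<close> splits the triangle \<open>a\<close>, \<open>b\<close>, \<open>c\<close> if
  its two coefficients have opposite signs, and the triangle \<open>a\<close>, \<open>- b\<close>, \<open>c\<close> if they have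
  equal signs.\<close>
lemma no_independent_triple:
  assumes fin: "finite R" "finite B"
    and symR: "\<And>r. r \<in> R \<Longrightarrow> - r \<in> R" and symB: "\<And>r. r \<in> B \<Longrightarrow> - r \<in> B"
    and RB: "spans_third R B" and BR: "spans_third B R"
    and abc: "a \<in> R" "b \<in> R" "c \<in> B"
  shows "\<not> independent_triple a b c"
proof
  assume ind: "independent_triple a b c"
  obtain d x y where d: "d \<in> B" "0 < x" "y \<noteq> 0" "d = x *\<^sub>R a + y *\<^sub>R b"
    using spans_thirdE[OF RB symB abc(1,2) independent_triple_imp_pair[OF ind]] by metis
  have "\<exists>b'. split_triangle R B a b' c"
  proof (cases "0 < y")
    case True
    have "x *\<^sub>R a - y *\<^sub>R (- b) \<in> B" using d by simp
    then show ?thesis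
      unfolding split_triangle_def
      using abc symR independent_triple_uminus_2[OF ind] d(2) True by blast
  next
    case False
    have "x *\<^sub>R a - (- y) *\<^sub>R b \<in> B" using d by simp
    moreover have "0 < - y" using False d(3) by simp
    ultimately show ?thesis
      unfolding split_triangle_def using abc ind d(2) by blast
  qed
  then show False using no_split_triangle[OF fin symR symB RB BR] by blast
qed


section \<open>Coloured points represented by vectors\<close>

lemma third_point_of_other_colour_sym:
  "third_point_of_other_colour col R B \<Longrightarrow> third_point_of_other_colour col B R"
  unfolding third_point_of_other_colour_def by blast

text \<open>One interface serves the affine and the projective plane. Only one
  direction is asked for, because the colour hypothesis supplies collinear triples.\<close>
definition represents_collinearity :: "('p \<Rightarrow> 'v::real_vector) \<Rightarrow> ('p set \<Rightarrow> bool) \<Rightarrow> bool" where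
  "represents_collinearity rep col \<longleftrightarrow>
     (\<forall>P Q. P \<noteq> Q \<longrightarrow> independent_pair (rep P) (rep Q)) \<and>
     (\<forall>P Q X. P \<noteq> Q \<longrightarrow> col {P, Q, X} \<longrightarrow> rep X \<in> span {rep P, rep Q})"

lemma represents_collinearity_pair:
  "represents_collinearity rep col \<Longrightarrow> P \<noteq> Q \<Longrightarrow> independent_pair (rep P) (rep Q)"
  unfolding represents_collinearity_def by blast

lemma represents_collinearity_span:
  "represents_collinearity rep col \<Longrightarrow> P \<noteq> Q \<Longrightarrow> col {P, Q, X} \<Longrightarrow> rep X \<in> span {rep P, rep Q}"
  unfolding represents_collinearity_def by blast

text \<open>Each point is given both of its representatives \<open>rep P\<close> and \<open>- rep P\<close>, since the descent
  has to be free to choose signs.\<close>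
lemma spans_third_representatives:
  fixes rep :: "'p \<Rightarrow> 'v::real_vector"
  assumes third: "third_point_of_other_colour col R B"
    and rep: "represents_collinearity rep col"
  shows "spans_third (rep ` R \<union> uminus ` rep ` R) (rep ` B \<union> uminus ` rep ` B)"
  unfolding spans_third_def
proof (intro ballI impI)
  have sign: "\<exists>P (s::real). P \<in> R \<and> (s = 1 \<or> s = - 1) \<and> v = s *\<^sub>R rep P"
    if "v \<in> rep ` R \<union> uminus ` rep ` R" for v
    using that
  proof
    assume "v \<in> rep ` R"
    then obtain P where "P \<in> R" "v = rep P" by blast
    then show ?thesis by (intro exI[of _ P] exI[of _ 1]) simp
  next
    assume "v \<in> uminus ` rep ` R"
    then obtain P where "P \<in> R" "v = - rep P" by blast
    then show ?thesis by (intro exI[of _ P] exI[of _ "- 1"]) simp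
  qed
  fix p q assume pq: "p \<in> rep ` R \<union> uminus ` rep ` R" "q \<in> rep ` R \<union> uminus ` rep ` R"
    and ind: "independent_pair p q"
  from sign[OF pq(1)] sign[OF pq(2)] obtain P Q and s t :: real where PQ: "P \<in> R" "Q \<in> R"
    and st: "s = 1 \<or> s = - 1" "t = 1 \<or> t = - 1"
    and p: "p = s *\<^sub>R rep P" and q: "q = t *\<^sub>R rep Q"
    by blast
  have "P \<noteq> Q"
  proof
    assume "P = Q"
    then have "t *\<^sub>R p + (- s) *\<^sub>R q = 0" by (simp add: p q mult.commute)
    then show False using ind st unfolding independent_pair_def by fastforce
  qed
  then obtain X where X: "X \<in> B" "X \<noteq> P" "X \<noteq> Q" "col {P, Q, X}"
    using third PQ unfolding third_point_of_other_colour_def by blast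
  then obtain x y where xy: "rep X = x *\<^sub>R rep P + y *\<^sub>R rep Q"
    using represents_collinearity_span[OF rep \<open>P \<noteq> Q\<close>] in_span_pair by metis
  have "x \<noteq> 0"
  proof
    assume "x = 0"
    then have "1 *\<^sub>R rep X + (- y) *\<^sub>R rep Q = 0" using xy by simp
    then show False using represents_collinearity_pair[OF rep X(3)] unfolding independent_pair_def by fastforce
  qed
  moreover have "y \<noteq> 0"
  proof
    assume "y = 0"
    then have "1 *\<^sub>R rep X + (- x) *\<^sub>R rep P = 0" using xy by simp
    then show False using represents_collinearity_pair[OF rep X(2)] unfolding independent_pair_def by fastforce
  qed
  moreover have "rep X = (x * s) *\<^sub>R p + (y * t) *\<^sub>R q"
    using st xy by (auto simp: p q)
  ultimately show "\<exists>r\<in>rep ` B \<union> uminus ` rep ` B. \<exists>x y. x \<noteq> 0 \<and> y \<noteq> 0 \<and> r = x *\<^sub>R p + y *\<^sub>R q"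
    using X(1) st by (metis UnI1 image_eqI mult_eq_0_iff zero_neq_neg_one zero_neq_one)
qed

lemma other_colour_in_span_of_pair:
  fixes rep :: "'p \<Rightarrow> 'v::real_vector"
  assumes fin: "finite R" "finite B"
    and third: "third_point_of_other_colour col R B"
    and rep: "represents_collinearity rep col"
    and PQX: "P \<in> R" "Q \<in> R" "P \<noteq> Q" "X \<in> B"
  shows "rep X \<in> span {rep P, rep Q}"
proof -
  let ?R = "rep ` R \<union> uminus ` rep ` R" and ?B = "rep ` B \<union> uminus ` rep ` B"
  have "spans_third ?R ?B"
    using spans_third_representatives[OF third rep] .
  moreover have "spans_third ?B ?R"
    using spans_third_representatives[OF third_point_of_other_colour_sym[OF third] rep] .
  ultimately have "\<not> independent_triple (rep P) (rep Q) (rep X)"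
    by (intro no_independent_triple[where R = ?R and B = ?B]) (use fin PQX in auto)
  then show ?thesis
    using not_independent_triple_imp_span[OF represents_collinearity_pair[OF rep PQX(3)]] by blast
qed

text \<open>A further red point \<open>Y\<close> is on the line: some blue point \<open>X\<close> other than \<open>P\<close> lies both on
  this line and on the line of \<open>P\<close> and \<open>Y\<close>, so the two lines share the distinct points \<open>P\<close>
  and \<open>X\<close>.\<close>
lemma coloured_points_in_span_of_red_pair:
  fixes rep :: "'p \<Rightarrow> 'v::real_vector"
  assumes fin: "finite R" "finite B"
    and third: "third_point_of_other_colour col R B"
    and rep: "represents_collinearity rep col"
    and PQ: "P \<in> R" "Q \<in> R" "P \<noteq> Q"
  shows "rep ` (R \<union> B) \<subseteq> span {rep P, rep Q}"
proof -
  note blue = other_colour_in_span_of_pair[OF fin third rep]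
  obtain X where X: "X \<in> B" "X \<noteq> P"
    using third PQ unfolding third_point_of_other_colour_def by blast
  have "rep Y \<in> span {rep P, rep Q}" if Y: "Y \<in> R" for Y
  proof (cases "Y = P")
    case True
    then show ?thesis by (simp add: span_base)
  next
    case False
    then obtain x y where xy: "rep X = x *\<^sub>R rep P + y *\<^sub>R rep Y"
      using blue[OF PQ(1) Y not_sym[OF False] X(1)] in_span_pair by metis
    have "y \<noteq> 0"
    proof
      assume "y = 0"
      then have "1 *\<^sub>R rep X + (- x) *\<^sub>R rep P = 0" using xy by simp
      then show False using represents_collinearity_pair[OF rep X(2)] unfolding independent_pair_def by fastforce
    qed
    then have "rep Y = (1 / y) *\<^sub>R (rep X - x *\<^sub>R rep P)" using xy by simp
    moreover have "rep X \<in> span {rep P, rep Q}" using blue[OF PQ X(1)] .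
    ultimately show ?thesis by (auto intro: span_scale span_diff span_base)
  qed
  then show ?thesis using blue[OF PQ] by blast
qed

lemma coloured_points_in_span_of_two:
  fixes rep :: "'p \<Rightarrow> 'v::real_vector"
  assumes fin: "finite R" "finite B"
    and third: "third_point_of_other_colour col R B"
    and rep: "represents_collinearity rep col"
  shows "\<exists>u v. rep ` (R \<union> B) \<subseteq> span {u, v}"
proof -
  \<comment> \<open>In the last case an empty colour class is also contained in a singleton.\<close>
  consider (red) P Q where "P \<in> R" "Q \<in> R" "P \<noteq> Q"
    | (blue) P Q where "P \<in> B" "Q \<in> B" "P \<noteq> Q"
    | (few) P Q where "R \<subseteq> {P}" "B \<subseteq> {Q}"
    by (metis singletonI subsetI)
  then show ?thesis
  proof cases
    case red
    then show ?thesis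
      using coloured_points_in_span_of_red_pair[OF fin third rep] by blast
  next
    case blue
    then show ?thesis
      using coloured_points_in_span_of_red_pair
        [OF fin(2,1) third_point_of_other_colour_sym[OF third] rep]
      by (metis Un_commute)
  next
    case few
    then have "rep ` (R \<union> B) \<subseteq> span {rep P, rep Q}" by (auto intro: span_base)
    then show ?thesis by blast
  qed
qed


section \<open>The affine and the projective plane\<close>

lemma affine_coloured_points_collinear:
  fixes R B :: "'a::real_vector set"
  assumes fin: "finite R" "finite B" and third: "third_point_of_other_colour collinear R B"
  shows "collinear (R \<union> B)"
proof -
  let ?h = "\<lambda>x::'a. (x, 1::real)"
  have pair: "independent_pair (?h P) (?h Q)" if "P \<noteq> Q" for P Q
    unfolding independent_pair_def
  proof (intro allI impI)
    fix x y assume "x *\<^sub>R ?h P + y *\<^sub>R ?h Q = 0"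
    then have "x *\<^sub>R P + y *\<^sub>R Q = 0" "y = - x" by (auto simp: zero_prod_def)
    then have "x *\<^sub>R (P - Q) = 0" by (simp add: algebra_simps)
    then show "x = 0 \<and> y = 0" using that \<open>y = - x\<close> by simp
  qed
  have col: "?h X \<in> span {?h P, ?h Q}" if "P \<noteq> Q" "collinear {P, Q, X}" for P Q X
  proof -
    obtain u where u: "\<And>x y. x \<in> {P, Q, X} \<Longrightarrow> y \<in> {P, Q, X} \<Longrightarrow> \<exists>c. x - y = c *\<^sub>R u"
      using \<open>collinear {P, Q, X}\<close> unfolding collinear_def by blast
    obtain s t where s: "Q - P = s *\<^sub>R u" and t: "X - P = t *\<^sub>R u"
      using u[of Q P] u[of X P] by auto
    have "s \<noteq> 0" using s \<open>P \<noteq> Q\<close> by auto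
    have "X - P = (t / s) *\<^sub>R (Q - P)" using \<open>s \<noteq> 0\<close> by (simp add: s t)
    then have "X = (1 - t / s) *\<^sub>R P + (t / s) *\<^sub>R Q" by (simp add: algebra_simps)
    then have "?h X = (1 - t / s) *\<^sub>R ?h P + (t / s) *\<^sub>R ?h Q" by simp
    then show ?thesis unfolding in_span_pair by blast
  qed
  have "represents_collinearity ?h collinear"
    unfolding represents_collinearity_def using pair col by blast
  then obtain u v where uv: "?h ` (R \<union> B) \<subseteq> span {u, v}"
    using coloured_points_in_span_of_two[OF fin third] by blast
  obtain p s q t where u: "u = (p, s)" and v: "v = (q, t)" by (metis surj_pair)
  have "\<exists>c. x - y = c *\<^sub>R (t *\<^sub>R p - s *\<^sub>R q)" if xy: "x \<in> R \<union> B" "y \<in> R \<union> B" for x y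
  proof -
    from xy obtain a b a' b' where "?h x = a *\<^sub>R u + b *\<^sub>R v" "?h y = a' *\<^sub>R u + b' *\<^sub>R v"
      using uv unfolding image_subset_iff in_span_pair by meson
    then have x: "x = a *\<^sub>R p + b *\<^sub>R q" "a * s + b * t = 1"
      and y: "y = a' *\<^sub>R p + b' *\<^sub>R q" "a' * s + b' * t = 1"
      by (simp_all add: u v)
    \<comment> \<open>Cramer's rule: \<open>(a - a', b - b')\<close> is orthogonal to \<open>(s, t)\<close>, hence a multiple of \<open>(t, - s)\<close>.\<close>
    have "a - a' = (a * b' - a' * b) * t" "b - b' = - ((a * b' - a' * b) * s)"
      using x(2) y(2) by algebra+
    then have "(a - a') *\<^sub>R p + (b - b') *\<^sub>R q
        = (a * b' - a' * b) *\<^sub>R (t *\<^sub>R p - s *\<^sub>R q)"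
      by (simp only: scaleR_diff_right scaleR_scaleR scaleR_minus_left add_uminus_conv_diff)
    moreover have "x - y = (a - a') *\<^sub>R p + (b - b') *\<^sub>R q"
      by (simp add: x(1) y(1) algebra_simps)
    ultimately show ?thesis by metis
  qed
  then show ?thesis unfolding collinear_def by blast
qed

definition proj_rep :: "proj_plane \<Rightarrow> real^3" where
  "proj_rep P = (SOME v. v \<noteq> 0 \<and> v \<in> proj_subspace P)"

lemma proj_subspace_eq_span: "proj_subspace P = span {proj_rep P}"
  and proj_rep_nonzero: "proj_rep P \<noteq> 0"
proof -
  have P: "subspace (proj_subspace P)" "dim (proj_subspace P) = 1"
    using proj_subspace[of P] by simp_all
  then have "\<exists>v. v \<noteq> 0 \<and> v \<in> proj_subspace P"
    by (metis dim_eq_0 subsetI singletonI zero_neq_one)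
  from someI_ex[OF this] have rep: "proj_rep P \<noteq> 0" "proj_rep P \<in> proj_subspace P"
    unfolding proj_rep_def by auto
  then have "span {proj_rep P} \<subseteq> proj_subspace P"
    using P(1) by (simp add: span_minimal)
  then show "proj_subspace P = span {proj_rep P}"
    using P rep(1) subspace_dim_equal[of "span {proj_rep P}" "proj_subspace P"]
    by (simp add: dim_insert)
  show "proj_rep P \<noteq> 0" using rep(1) .
qed

lemma dim_independent_pair:
  fixes u v :: "'a::euclidean_space"
  assumes "independent_pair u v"
  shows "dim {u, v} = 2"
proof -
  have "v \<noteq> 0"
    using assms unfolding independent_pair_def
    by (metis add_0_right scaleR_zero_left scaleR_zero_right zero_neq_one)
  moreover have "u \<notin> span {v}"
  proof
    assume "u \<in> span {v}"
    then obtain k where "u = k *\<^sub>R v" by (auto simp: span_singleton)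
    then have "1 *\<^sub>R u + (- k) *\<^sub>R v = 0" by simp
    then show False using assms unfolding independent_pair_def by fastforce
  qed
  ultimately show ?thesis by (simp add: dim_insert)
qed

lemma independent_pair_proj_rep:
  assumes "P \<noteq> Q" shows "independent_pair (proj_rep P) (proj_rep Q)"
proof (rule ccontr)
  assume "\<not> independent_pair (proj_rep P) (proj_rep Q)"
  then obtain x y where eq: "x *\<^sub>R proj_rep P + y *\<^sub>R proj_rep Q = 0" and nz: "x \<noteq> 0 \<or> y \<noteq> 0"
    unfolding independent_pair_def by blast
  have "x \<noteq> 0" using eq nz proj_rep_nonzero[of Q] by auto
  have "proj_rep P = (- y / x) *\<^sub>R proj_rep Q"
  proof -
    have "x *\<^sub>R proj_rep P = (- y) *\<^sub>R proj_rep Q" using eq by (simp add: add_eq_0_iff)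
    then have "(1 / x) *\<^sub>R x *\<^sub>R proj_rep P = (1 / x) *\<^sub>R (- y) *\<^sub>R proj_rep Q" by simp
    then show ?thesis using \<open>x \<noteq> 0\<close> by simp
  qed
  then have "proj_subspace P \<subseteq> proj_subspace Q"
    unfolding proj_subspace_eq_span
    by (metis empty_subsetI insert_subset span_base span_minimal span_scale singletonI subspace_span)
  then have "proj_subspace P = proj_subspace Q"
    using proj_subspace[of P] proj_subspace[of Q] by (intro subspace_dim_equal) auto
  then show False using assms proj_subspace_inject by blast
qed

lemma proj_collinear_imp_span:
  assumes "P \<noteq> Q" "proj_collinear {P, Q, X}"
  shows "proj_rep X \<in> span {proj_rep P, proj_rep Q}"
proof -
  obtain L where L: "subspace L" "dim L = 2" and "\<forall>P\<in>{P, Q, X}. proj_subspace P \<subseteq> L"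
    using assms(2) unfolding proj_collinear_def proj_line_def by blast
  then have in_L: "proj_rep P \<in> L" "proj_rep Q \<in> L" "proj_rep X \<in> L"
    unfolding proj_subspace_eq_span by (auto intro: span_base)
  have "span {proj_rep P, proj_rep Q} = L"
    using L in_L dim_independent_pair[OF independent_pair_proj_rep[OF assms(1)]]
    by (intro subspace_dim_equal) (auto simp: span_minimal)
  then show ?thesis using in_L(3) by simp
qed

lemma represents_collinearity_proj_rep: "represents_collinearity proj_rep proj_collinear"
  unfolding represents_collinearity_def
  using independent_pair_proj_rep proj_collinear_imp_span by blast

lemma proj_collinear_of_span:
  assumes "proj_rep ` T \<subseteq> span {u, v}"
  shows "proj_collinear T"
proof -
  \<comment> \<open>\<open>u\<close> and \<open>v\<close> may be dependent, so the line is taken as a plane through the origin that contains them.\<close>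
  have "dim {u, v} \<le> 2"
    by (rule order_trans[OF dim_le_card']) (auto simp: card_insert_if)
  then obtain n where n: "n \<noteq> 0" "span {u, v} \<subseteq> {x. n \<bullet> x = 0}"
    using lowdim_subset_hyperplane[of "{u, v}"] by auto
  let ?L = "{x. n \<bullet> x = 0}"
  have L: "subspace ?L" "dim ?L = 2"
    using n(1) by (simp_all add: subspace_hyperplane dim_hyperplane)
  have "proj_subspace P \<subseteq> ?L" if "P \<in> T" for P
    unfolding proj_subspace_eq_span using assms n(2) L(1) that by (intro span_minimal) auto
  then show ?thesis unfolding proj_collinear_def proj_line_def using L by blast
qed

theorem theorem1:
  "(\<forall>S R B :: (real^2) set.
      finite S \<and> S = R \<union> B \<and> third_point_of_other_colour collinear R B
        \<longrightarrow> collinear S) \<and>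
   (\<forall>S R B :: proj_plane set.
      finite S \<and> S = R \<union> B \<and> third_point_of_other_colour proj_collinear R B
        \<longrightarrow> proj_collinear S)"
proof (intro conjI allI impI)
  fix S R B :: "(real^2) set"
  assume "finite S \<and> S = R \<union> B \<and> third_point_of_other_colour collinear R B"
  then show "collinear S" using affine_coloured_points_collinear[of R B] by auto
next
  fix S R B :: "proj_plane set"
  assume S: "finite S \<and> S = R \<union> B \<and> third_point_of_other_colour proj_collinear R B"
  then have "finite R" "finite B" "third_point_of_other_colour proj_collinear R B" by auto
  from coloured_points_in_span_of_two
    [OF this represents_collinearity_proj_rep]
  obtain u v where "proj_rep ` (R \<union> B) \<subseteq> span {u, v}" by blast
  then show "proj_collinear S" using S proj_collinear_of_span by blast
qed

end
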